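(* Let $I=[P,Q]$ be a Tamari interval of size $n$, with contact vector $(c_0(I),\dots,c_n(I))$ and descent vector $(d_0(I),\dots,d_n(I))$. For $0\le i\le n$, (where either $c_i(I)=0$ or $d_{n-i}(I)=0$) define the word $w_i$ by $$w_i=\begin{cases}E^{c_i(I)-1}N & \text{if } c_i(I)\ge1 \text{ and } d_{n-i}(I)=0,\\ WS^{d_{n-i}(I)-1} & \text{if } c_i(I)=0 \text{ and } d_{n-i}(I)\ge1,\\ V & \text{if } c_i(I)=0\text{ and } d_{n-i}(I)=0.\end{cases}$$ Then the word $Ew_0w_1\cdots w_nS$ is the extended fighting fish $\Phi(I)$.
   Context: **Fish.** Non-empty fighting fish are the words on $\{E,N,W,S\}$ obtainable from $ENWS$ by finitely many operations of the form: replace a factor (contiguous subword) $W$ by $NWS$; replace a factor $N$ by $ENW$; replace a factor $WN$ by $NW$. Non-empty extended fighting fish are the words on $\{E,N,W,S,V\}$ obtained from a non-empty fighting fish by choosing a (possibly empty) set of occurrences of the factor $WN$ and replacing each chosen one by $V$. The empty fish $\varepsilon$ is the word $EVS$, also considered an extended fighting fish. The jaw length $\mathrm{jaw}(F)$ of a non-empty $F$ is the number of initial consecutive letters $E$ (the next letter is then always $N$); $\mathrm{jaw}(\varepsilon)=0$. Concatenation: for non-empty $F_1=G_1S$ and $F_2=E^{\mathrm{jaw}(F_2)}NG_2$, $F_1\odot F_2=E^{\mathrm{jaw}(F_2)}G_1G_2$; and $F\odot\varepsilon=\varepsilon\odot F=F$. Augmentation: for non-empty $F=E^{j}NG$ with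 $j=\mathrm{jaw}(F)$, $\maltese_i(F)=E^iNE^{j-i}NGS$ if $1\le i\le j$, and $\maltese_{j+1}(F)=E^{j+1}NVGS$; and $\maltese_1(\varepsilon)=ENWS$. A pointed extended fighting fish $F^{\bullet i}$ is a pair $(F,i)$ with $1\le i\le \mathrm{jaw}(F)+1$. Set $\oplus_{\mathcal F}(F_1^{\bullet i},F_2)=\maltese_i(F_1)\odot F_2$. **Dyck paths.** A Dyck path of size $n$ is a word with $n$ letters $u=(1,1)$ and $n$ letters $d=(1,-1)$, seen as a walk from $(0,0)$ staying weakly above the $x$-axis; $\bullet$ is the empty path. A contact is a point of the path on the $x$-axis. The Tamari order $\preceq$ on Dyck paths of size $n$ is the reflexive transitive closure of: $VdP_1W$ is covered by $VP_1dW$, where $V,W$ are words and $P_1$ is a non-empty Dyck path returning to the $x$-axis only at its end. The contact vector of $P$ is $(c_0(P),\dots,c_n(P))$ where $c_0(P)$ is the number of non-initial contacts of $P$ and $c_k(P)$, $k\ge1$, is the number of non-initial contacts of the (maximal) Dyck path following the $k$-th up step of $P$. The descent vector of $P$ is $(d_0(P),\dots,d_n(P))$, the nonnegative integers with $P=d^{d_n(P)}u\,d^{d_{n-1}(P)}u\cdots u\,d^{d_0(P)}$. **Intervals.** A Tamari interval of size $n$ is a pair $I=[P,Q]$ of Dyck paths of size $n$ with $P\preceq Q$; $c_k(I)=c_k(P)$ and $d_k(I)=d_k(Q)$. A pointed Tamari interval $I^{\bullet i}$ is an interval $I=[P,Q]$ with an integer $1\le i\le c_0(I)+1$; it singles out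 the $i$-th contact of $P$ counted from right to left, which splits $P=P^\ell P^r$ into two (possibly empty) Dyck paths. Set $[P_1,Q_1]\odot[P_2,Q_2]=[P_1P_2,Q_1Q_2]$, $\maltese_i([P_1,Q_1])=[uP_1^\ell dP_1^r,uQ_1d]$, and $\oplus_{\mathcal I}(I_1^{\bullet i},I_2)=\maltese_i(I_1)\odot I_2$. It is known that $\oplus_{\mathcal I}$ is a bijection from pairs (pointed Tamari interval, Tamari interval) to Tamari intervals different from $[\bullet,\bullet]$. **The map $\Phi$.** $\Phi$ is the map from Tamari intervals to extended fighting fish defined recursively by $\Phi([\bullet,\bullet])=\varepsilon$ and $\Phi(\oplus_{\mathcal I}(I_1^{\bullet i},I_2))=\oplus_{\mathcal F}(\Phi(I_1)^{\bullet i},\Phi(I_2))$; this is well defined because $\mathrm{jaw}(\Phi(I))=c_0(I)$ for every $I$. For every Tamari interval $I$ of size $n$ and $0\le i\le n$, it holds that $c_i(I)=0$ or $d_{n-i}(I)=0$, so exactly one case in the definition of $w_i$ applies. *)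

theory Defs
  imports Main
begin

section \<open>Extended fighting fish\<close>

datatype letter = E | N | W | S | V

inductive fighting_fish :: "letter list \<Rightarrow> bool" where
  start: "fighting_fish [E, N, W, S]"
| split_W: "fighting_fish (A @ [W] @ B) \<Longrightarrow> fighting_fish (A @ [N, W, S] @ B)"
| split_N: "fighting_fish (A @ [N] @ B) \<Longrightarrow> fighting_fish (A @ [E, N, W] @ B)"
| glue: "fighting_fish (A @ [W, N] @ B) \<Longrightarrow> fighting_fish (A @ [N, W] @ B)"

text \<open>
  \<open>contract_WN A B\<close>: \<open>B\<close> arises from \<open>A\<close> by replacing a chosen set of occurrences of the
  factor \<open>WN\<close> by \<open>V\<close>. Distinct occurrences of \<open>WN\<close> never overlap, so one pass suffices.
\<close>

inductive contract_WN :: "letter list \<Rightarrow> letter list \<Rightarrow> bool" where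
  nil: "contract_WN [] []"
| keep: "contract_WN A B \<Longrightarrow> contract_WN (x # A) (x # B)"
| contract: "contract_WN A B \<Longrightarrow> contract_WN (W # N # A) (V # B)"

definition empty_fish :: "letter list" where
  "empty_fish = [E, V, S]"

definition extended_fighting_fish :: "letter list \<Rightarrow> bool" where
  "extended_fighting_fish F \<longleftrightarrow>
     F = empty_fish \<or> (\<exists>F'. fighting_fish F' \<and> contract_WN F' F)"

definition jaw :: "letter list \<Rightarrow> nat" where
  "jaw F = (if F = empty_fish then 0 else length (takeWhile (\<lambda>x. x = E) F))"

text \<open>
  On a non-empty fish \<open>F = E\<^sup>j N G\<close> with \<open>j = jaw F\<close>, the word \<open>G\<close> is \<open>drop (j + 1) F\<close>; on a
  fish \<open>F = G S\<close>, the word \<open>G\<close> is \<open>butlast F\<close>.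
\<close>

definition fish_concat :: "letter list \<Rightarrow> letter list \<Rightarrow> letter list" where
  "fish_concat F1 F2 =
     (if F1 = empty_fish then F2
      else if F2 = empty_fish then F1
      else replicate (jaw F2) E @ butlast F1 @ drop (jaw F2 + 1) F2)"

text \<open>Only meaningful for \<open>1 \<le> i \<le> jaw F + 1\<close>.\<close>

definition fish_augment :: "nat \<Rightarrow> letter list \<Rightarrow> letter list" where
  "fish_augment i F =
     (if F = empty_fish then [E, N, W, S]
      else let j = jaw F; G = drop (j + 1) F in
        if i \<le> j then replicate i E @ [N] @ replicate (j - i) E @ [N] @ G @ [S]
        else replicate (j + 1) E @ [N, V] @ G @ [S])"

definition fish_oplus :: "letter list \<Rightarrow> nat \<Rightarrow> letter list \<Rightarrow> letter list" where
  "fish_oplus F1 i F2 = fish_concat (fish_augment i F1) F2"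


section \<open>Dyck paths\<close>

datatype step = U | D

definition path_height :: "step list \<Rightarrow> int" where
  "path_height p = int (count_list p U) - int (count_list p D)"

definition dyck_path :: "step list \<Rightarrow> bool" where
  "dyck_path p \<longleftrightarrow> path_height p = 0 \<and> (\<forall>k\<le>length p. path_height (take k p) \<ge> 0)"

definition path_size :: "step list \<Rightarrow> nat" where
  "path_size p = count_list p U"

text \<open>
  Contacts are identified by their abscissas, listed from left to right; for a Dyck path the
  first one is the initial point.
\<close>

definition contact_positions :: "step list \<Rightarrow> nat list" where
  "contact_positions p = filter (\<lambda>k. path_height (take k p) = 0) [0..<length p + 1]"

definition noninitial_contacts :: "step list \<Rightarrow> nat" where
  "noninitial_contacts p = length (tl (contact_positions p))"

definition prime_dyck_path :: "step list \<Rightarrow> bool" where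
  "prime_dyck_path p \<longleftrightarrow>
     dyck_path p \<and> p \<noteq> [] \<and> (\<forall>k. 0 < k \<and> k < length p \<longrightarrow> path_height (take k p) \<noteq> 0)"

inductive tamari_cover :: "step list \<Rightarrow> step list \<Rightarrow> bool" where
  "dyck_path (A @ [D] @ P1 @ B) \<Longrightarrow> prime_dyck_path P1 \<Longrightarrow>
     tamari_cover (A @ [D] @ P1 @ B) (A @ P1 @ [D] @ B)"

definition tamari_le :: "step list \<Rightarrow> step list \<Rightarrow> bool" where
  "tamari_le P Q \<longleftrightarrow> dyck_path P \<and> dyck_path Q \<and> tamari_cover\<^sup>*\<^sup>* P Q"

text \<open>The part of a path after its \<open>k\<close>-th up step.\<close>

fun after_up :: "nat \<Rightarrow> step list \<Rightarrow> step list" where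
  "after_up 0 p = p"
| "after_up (Suc k) [] = []"
| "after_up (Suc k) (U # p) = after_up k p"
| "after_up (Suc k) (D # p) = after_up (Suc k) p"

definition max_dyck_prefix :: "step list \<Rightarrow> step list" where
  "max_dyck_prefix p = take (Max {m. m \<le> length p \<and> dyck_path (take m p)}) p"

definition contact :: "step list \<Rightarrow> nat \<Rightarrow> nat" where
  "contact P k =
     (if k = 0 then noninitial_contacts P
      else noninitial_contacts (max_dyck_prefix (after_up k P)))"

text \<open>
  This says \<open>P = D^(ds!n) U D^(ds!(n-1)) U \<dots> U D^(ds!0)\<close> with \<open>n = path_size P\<close>: the entries
  are indexed from right to left.
\<close>

definition is_descent_vector :: "nat list \<Rightarrow> step list \<Rightarrow> bool" where
  "is_descent_vector ds P \<longleftrightarrow>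
     length ds = path_size P + 1 \<and>
     P = replicate (ds ! path_size P) D @
         concat (map (\<lambda>k. U # replicate (ds ! k) D) (rev [0..<path_size P]))"

definition descent :: "step list \<Rightarrow> nat \<Rightarrow> nat" where
  "descent P k = (THE ds. is_descent_vector ds P) ! k"

lemma ex1_descent_vector: "\<exists>!ds. is_descent_vector ds P"
proof (induction P)
  case Nil
  show ?case
  proof (rule ex1I)
    show "is_descent_vector [0] []" by (simp add: is_descent_vector_def path_size_def)
  next
    fix ds assume "is_descent_vector ds []"
    then show "ds = [0]" by (auto simp: is_descent_vector_def path_size_def length_Suc_conv)
  qed
next
  case (Cons x P)
  let ?n = "path_size P"
  obtain ds where ds: "is_descent_vector ds P"
    and uniq: "\<And>es. is_descent_vector es P \<Longrightarrow> es = ds"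
    using Cons.IH by blast
  have len: "length ds = ?n + 1"
    and P: "P = replicate (ds ! ?n) D @ concat (map (\<lambda>k. U # replicate (ds ! k) D) (rev [0..<?n]))"
    using ds by (auto simp: is_descent_vector_def)
  have cong: "map (\<lambda>k. U # replicate (es ! k) D) (rev [0..<m]) =
      map (\<lambda>k. U # replicate (fs ! k) D) (rev [0..<m])"
    if "\<And>k. k < m \<Longrightarrow> es ! k = fs ! k" for es fs :: "nat list" and m
    using that by (auto simp: rev_map[symmetric])
  show ?case
  proof (cases x)
    case U
    have size: "path_size (x # P) = Suc ?n" by (simp add: U path_size_def)
    show ?thesis
    proof (rule ex1I)
      have "U # P = concat (map (\<lambda>k. U # replicate ((ds @ [0]) ! k) D) (rev [0..<Suc ?n]))"
        using P cong[of ?n ds "ds @ [0]"] len by (simp add: nth_append)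
      then show "is_descent_vector (ds @ [0]) (x # P)"
        unfolding is_descent_vector_def size using len U by (simp add: nth_append)
    next
      fix es assume es: "is_descent_vector es (x # P)"
      then have l: "length es = Suc ?n + 1"
        and eq: "U # P = replicate (es ! Suc ?n) D @
          concat (map (\<lambda>k. U # replicate (es ! k) D) (rev [0..<Suc ?n]))"
        using size U by (auto simp: is_descent_vector_def)
      have z: "es ! Suc ?n = 0" using eq by (cases "es ! Suc ?n") auto
      let ?b = "butlast es"
      have "P = replicate (?b ! ?n) D @ concat (map (\<lambda>k. U # replicate (?b ! k) D) (rev [0..<?n]))"
        using eq z cong[of ?n es ?b] l by (simp add: nth_butlast)
      then have "is_descent_vector ?b P" using l by (simp add: is_descent_vector_def)
      then have "?b = ds" by (rule uniq)
      moreover have "last es = 0" using z l by (subst last_conv_nth) auto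
      ultimately show "es = ds @ [0]" using l
        by (metis append_butlast_last_id list.size(3) add_eq_0_iff_both_eq_0 one_neq_zero)
    qed
  next
    case D
    have size: "path_size (x # P) = ?n" by (simp add: D path_size_def)
    show ?thesis
    proof (rule ex1I)
      let ?es = "ds[?n := Suc (ds ! ?n)]"
      show "is_descent_vector ?es (x # P)"
        unfolding is_descent_vector_def size using P cong[of ?n ds ?es] len D by simp
    next
      fix es assume es: "is_descent_vector es (x # P)"
      then have l: "length es = ?n + 1"
        and eq: "D # P = replicate (es ! ?n) D @
          concat (map (\<lambda>k. U # replicate (es ! k) D) (rev [0..<?n]))"
        using size D by (auto simp: is_descent_vector_def)
      have "es ! ?n \<noteq> 0"
      proof
        assume "es ! ?n = 0"
        then show False using eq by (cases "?n") auto
      qed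
      then obtain m where m: "es ! ?n = Suc m" by (cases "es ! ?n") auto
      let ?b = "es[?n := m]"
      have "P = replicate (?b ! ?n) D @ concat (map (\<lambda>k. U # replicate (?b ! k) D) (rev [0..<?n]))"
        using eq m cong[of ?n es ?b] l by simp
      then have "is_descent_vector ?b P" using l by (simp add: is_descent_vector_def)
      then have "?b = ds" by (rule uniq)
      then show "es = ds[?n := Suc (ds ! ?n)]"
        using m l by (metis list_update_id list_update_overwrite nth_list_update_eq
            less_add_one)
    qed
  qed
qed


section \<open>Tamari intervals\<close>

type_synonym interval = "step list \<times> step list"

definition tamari_interval :: "interval \<Rightarrow> bool" where
  "tamari_interval I \<longleftrightarrow> tamari_le (fst I) (snd I)"

definition interval_size :: "interval \<Rightarrow> nat" where
  "interval_size I = path_size (fst I)"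

definition interval_contact :: "interval \<Rightarrow> nat \<Rightarrow> nat" where
  "interval_contact I k = contact (fst I) k"

definition interval_descent :: "interval \<Rightarrow> nat \<Rightarrow> nat" where
  "interval_descent I k = descent (snd I) k"

definition pointed_interval :: "interval \<Rightarrow> nat \<Rightarrow> bool" where
  "pointed_interval I i \<longleftrightarrow>
     tamari_interval I \<and> 1 \<le> i \<and> i \<le> interval_contact I 0 + 1"

definition left_part :: "step list \<Rightarrow> nat \<Rightarrow> step list" where
  "left_part P i = take (rev (contact_positions P) ! (i - 1)) P"

definition right_part :: "step list \<Rightarrow> nat \<Rightarrow> step list" where
  "right_part P i = drop (rev (contact_positions P) ! (i - 1)) P"

definition interval_concat :: "interval \<Rightarrow> interval \<Rightarrow> interval" where
  "interval_concat I1 I2 = (fst I1 @ fst I2, snd I1 @ snd I2)"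

definition interval_augment :: "nat \<Rightarrow> interval \<Rightarrow> interval" where
  "interval_augment i I =
     ([U] @ left_part (fst I) i @ [D] @ right_part (fst I) i, [U] @ snd I @ [D])"

definition interval_oplus :: "interval \<Rightarrow> nat \<Rightarrow> interval \<Rightarrow> interval" where
  "interval_oplus I1 i I2 = interval_concat (interval_augment i I1) I2"


section \<open>The map from Tamari intervals to extended fighting fish\<close>

text \<open>
  The recursion runs along the decomposition of intervals by \<^const>\<open>interval_oplus\<close>, which is not a
  constructor; the recursive equations are therefore taken as the rules of an inductive graph.
\<close>

inductive Phi_graph :: "interval \<Rightarrow> letter list \<Rightarrow> bool" where
  empty: "Phi_graph ([], []) empty_fish"
| oplus: "pointed_interval I1 i \<Longrightarrow> tamari_interval I2 \<Longrightarrow>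
    Phi_graph I1 F1 \<Longrightarrow> Phi_graph I2 F2 \<Longrightarrow>
    Phi_graph (interval_oplus I1 i I2) (fish_oplus F1 i F2)"

definition Phi :: "interval \<Rightarrow> letter list" where
  "Phi I = (THE F. Phi_graph I F)"


section \<open>The word of an interval\<close>

text \<open>
  The factor \<open>w\<^sub>i\<close> as a function of \<open>c\<^sub>i\<close> and \<open>d\<^sub>n\<^sub>-\<^sub>i\<close>. Both being positive does not occur for
  Tamari intervals, and no value is prescribed then.
\<close>

definition fish_factor :: "nat \<Rightarrow> nat \<Rightarrow> letter list" where
  "fish_factor c d =
     (if c \<ge> 1 \<and> d = 0 then replicate (c - 1) E @ [N]
      else if c = 0 \<and> d \<ge> 1 then [W] @ replicate (d - 1) S
      else if c = 0 \<and> d = 0 then [V]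
      else undefined)"

end

theory Submission
  imports Defs
begin

text \<open>
  Two facts combine to give the theorem.

  First, the word read off from contacts and descents obeys the recursion that defines the fish.
  Let \<open>I\<^sub>1 = [P\<^sub>1, Q\<^sub>1]\<close> be pointed at its \<open>i\<close>-th contact from the right, and \<open>I\<^sub>2 = [P\<^sub>2, Q\<^sub>2]\<close>. The
  path \<open>U P\<^sub>1\<^sup>l D P\<^sub>1\<^sup>r P\<^sub>2\<close> has contact vector \<open>i + c\<^sub>0(P\<^sub>2), c\<^sub>0(P\<^sub>1) - (i - 1)\<close>, followed by the contact
  vectors of \<open>P\<^sub>1\<close> and \<open>P\<^sub>2\<close> without their entries of index 0. From left to right, the descents of
  \<open>U Q\<^sub>1 D Q\<^sub>2\<close> are a 0, those of \<open>Q\<^sub>1\<close> with the last one increased by 1, and those of \<open>Q\<^sub>2\<close> without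
  the first one, which is 0. The new letters are thus a jaw with its \<open>N\<close>, one further factor
  \<open>E\<^sup>j\<^sup>-\<^sup>i N\<close> or \<open>V\<close> where \<open>j = c\<^sub>0(P\<^sub>1)\<close>, and one \<open>S\<close> at the end of the first block: exactly what
  augmentation and concatenation insert (\<open>fish_word_oplus\<close>; if \<open>I\<^sub>1\<close> is empty, the block after the
  new \<open>N\<close> is the single factor \<open>W\<close>). Since concatenation and augmentation preserve extended
  fighting fish, every fish that the recursion assigns to an interval is an extended fish, and it
  is the word of the interval (\<open>Phi_graph_fish_word\<close>). In particular it depends only on
  the interval, so the recursion is single-valued.

  Secondly, the recursion reaches every Tamari interval (\<open>Phi_graph_total\<close>). Let \<open>P\<close> lie below
  \<open>Q = U Q\<^sub>1 D Q\<^sub>2\<close>. Going down from \<open>Q\<close> along covers, the path keeps the form \<open>U L D R P\<^sub>2\<close> with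
  \<open>L R\<close> below \<open>Q\<^sub>1\<close> and \<open>P\<^sub>2\<close> below \<open>Q\<^sub>2\<close>: a cover acts inside one of \<open>L\<close>, \<open>R\<close>, \<open>P\<^sub>2\<close>, or it moves the
  displayed \<open>D\<close> over the last prime factor of \<open>L\<close>, which then passes from \<open>L\<close> to \<open>R\<close> and leaves
  \<open>L R\<close> unchanged (\<open>tree_interval_decomposition\<close>).

  All of this is carried out on binary trees, which encode Dyck paths by their first-return
  decomposition: Tamari covers become tree rotations, and case distinctions on positions in a word
  become structural inductions.
\<close>

section \<open>Dyck paths as binary trees\<close>

datatype btree = Leaf | Node btree btree

fun dyck_word :: "btree \<Rightarrow> step list" where
  "dyck_word Leaf = []"
| "dyck_word (Node l r) = U # dyck_word l @ D # dyck_word r"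

text \<open>
  The right branch of a tree lists the prime factors of its Dyck path. Hence concatenation of paths
  is grafting at the end of the right branch, and \<open>spine\<close> below counts the non-initial contacts.
\<close>

fun graft :: "btree \<Rightarrow> btree \<Rightarrow> btree" where
  "graft Leaf t = t"
| "graft (Node l r) t = Node l (graft r t)"

fun spine :: "btree \<Rightarrow> nat" where
  "spine Leaf = 0"
| "spine (Node l r) = Suc (spine r)"

lemma dyck_word_graft [simp]: "dyck_word (graft s t) = dyck_word s @ dyck_word t"
  by (induction s) auto

lemma graft_Leaf [simp]: "graft s Leaf = s"
  by (induction s) auto

lemma graft_assoc: "graft (graft s t) u = graft s (graft t u)"
  by (induction s) auto

lemma spine_graft [simp]: "spine (graft s t) = spine s + spine t"
  by (induction s) auto

text \<open>
  Each contact of a path splits it into two Dyck paths; this realises the pointing of an interval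
  on trees.
\<close>

lemma graft_split: "k \<le> spine s \<Longrightarrow> \<exists>l r. s = graft l r \<and> spine r = k"
proof (induction s)
  case Leaf
  then show ?case by (intro exI[of _ Leaf]) auto
next
  case (Node a b)
  show ?case
  proof (cases "k = Suc (spine b)")
    case True
    then show ?thesis by (intro exI[of _ Leaf] exI[of _ "Node a b"]) auto
  next
    case False
    then obtain l r where "b = graft l r" "spine r = k" using Node by auto
    then show ?thesis by (intro exI[of _ "Node a l"] exI[of _ r]) auto
  qed
qed

lemma path_height_simps [simp]:
  "path_height [] = 0"
  "path_height (U # p) = path_height p + 1"
  "path_height (D # p) = path_height p - 1"
  "path_height (p @ q) = path_height p + path_height q"
  by (auto simp: path_height_def)

lemma path_size_simps [simp]:
  "path_size [] = 0"
  "path_size (U # p) = Suc (path_size p)"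
  "path_size (D # p) = path_size p"
  "path_size (p @ q) = path_size p + path_size q"
  by (auto simp: path_size_def)

lemma height_dyck_word [simp]: "path_height (dyck_word s) = 0"
  by (induction s) auto

lemma height_take_dyck_word: "0 \<le> path_height (take k (dyck_word s))"
proof (induction s arbitrary: k)
  case (Node l r)
  show ?case
  proof (cases k)
    case (Suc m)
    have "- 1 \<le> path_height (take m (dyck_word l @ D # dyck_word r))"
    proof (cases "m \<le> length (dyck_word l)")
      case True
      then show ?thesis using Node.IH(1)[of m] by simp
    next
      case False
      then show ?thesis using Node.IH(2)[of "m - length (dyck_word l) - 1"]
        by (simp add: take_Cons')
    qed
    then show ?thesis using Suc by simp
  qed simp
qed simp

lemma height_prefix_dyck_word: "dyck_word s = p @ q \<Longrightarrow> 0 \<le> path_height p"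
  using height_take_dyck_word[of "length p" s] by simp

lemma dyck_path_dyck_word [simp]: "dyck_path (dyck_word s)"
  by (simp add: dyck_path_def height_take_dyck_word)

text \<open>
  Generalising from Dyck paths to paths that descend by \<open>h\<close> in total makes induction on the word
  possible: such a path consists of \<open>h + 1\<close> Dyck paths separated by \<open>h\<close> down steps. A leading \<open>U\<close>
  merges the first two of them into one, a leading \<open>D\<close> puts an empty one in front.
\<close>

lemma tree_stack_of_path:
  assumes "path_height p = - int h" and "\<And>k. - int h \<le> path_height (take k p)"
  shows "\<exists>t ts. length ts = h \<and> p = dyck_word t @ concat (map (\<lambda>t. D # dyck_word t) ts)"
  using assms
proof (induction p arbitrary: h)
  case Nil
  then show ?case by (intro exI[of _ Leaf] exI[of _ "[]"]) auto
next
  case (Cons x p)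
  show ?case
  proof (cases x)
    case U
    have "- int (Suc h) \<le> path_height (take k p)" for k
      using Cons.prems(2)[of "Suc k"] U by simp
    then obtain t ts where *: "length ts = Suc h"
        "p = dyck_word t @ concat (map (\<lambda>t. D # dyck_word t) ts)"
      using Cons.IH[of "Suc h"] Cons.prems(1) U by auto
    then obtain t' ts' where "ts = t' # ts'" by (cases ts) auto
    then show ?thesis using * U by (intro exI[of _ "Node t t'"] exI[of _ ts']) auto
  next
    case D
    obtain g where g: "h = Suc g" using Cons.prems(2)[of 1] D by (cases h) auto
    have "- int g \<le> path_height (take k p)" for k
      using Cons.prems(2)[of "Suc k"] D g by simp
    then obtain t ts where *: "length ts = g"
        "p = dyck_word t @ concat (map (\<lambda>t. D # dyck_word t) ts)"
      using Cons.IH[of g] Cons.prems(1) D g by auto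
    then show ?thesis using D g by (intro exI[of _ Leaf] exI[of _ "t # ts"]) auto
  qed
qed

lemma dyck_path_obtains_tree:
  assumes "dyck_path p"
  obtains s where "p = dyck_word s"
proof -
  have "0 \<le> path_height (take k p)" for k
    using assms by (cases "k \<le> length p") (auto simp: dyck_path_def)
  then show thesis
    using tree_stack_of_path[of p 0] assms that by (auto simp: dyck_path_def)
qed


section \<open>Contacts and descents on trees\<close>

lemma contact_positions_append:
  assumes "path_height p = 0"
  shows "contact_positions (p @ q) =
    filter (\<lambda>k. path_height (take k p) = 0) [0..<length p] @
    map (\<lambda>k. k + length p) (contact_positions q)"
proof -
  have "[0..<length (p @ q) + 1] =
      [0..<length p] @ map (\<lambda>k. k + length p) [0..<length q + 1]"
    by (simp add: map_add_upt upt_add_eq_append[of 0 "length p" "length q", simplified] add.commute)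
  moreover have "filter (\<lambda>k. path_height (take k (p @ q)) = 0) [0..<length p] =
      filter (\<lambda>k. path_height (take k p) = 0) [0..<length p]"
    by (rule filter_cong) auto
  ultimately show ?thesis
    using assms by (simp add: contact_positions_def filter_map o_def)
qed

lemma height_inside_prime:
  assumes "0 < k" "k < length (U # dyck_word l @ [D])"
  shows "0 < path_height (take k (U # dyck_word l @ [D]))"
proof -
  obtain m where "k = Suc m" using assms(1) by (cases k) auto
  then show ?thesis using assms(2) height_take_dyck_word[of m l] by simp
qed

lemma contact_positions_prime:
  "filter (\<lambda>k. path_height (take k (U # dyck_word l @ [D])) = 0)
    [0..<length (U # dyck_word l @ [D])] = [0]"
proof -
  let ?p = "U # dyck_word l @ [D]"
  have "path_height (take k ?p) \<noteq> 0" if "k \<in> set [1..<length ?p]" for k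
    using height_inside_prime[of k l] that by fastforce
  then have "filter (\<lambda>k. path_height (take k ?p) = 0) [1..<length ?p] = []"
    unfolding filter_empty_conv by blast
  moreover have "[0..<length ?p] = 0 # [1..<length ?p]"
    by (simp add: upt_conv_Cons del: upt_Suc)
  ultimately show ?thesis by simp
qed

lemma contact_positions_dyck_word:
  "length (contact_positions (dyck_word s)) = Suc (spine s)
    \<and> hd (contact_positions (dyck_word s)) = 0"
proof (induction s)
  case Leaf
  then show ?case by (simp add: contact_positions_def)
next
  case (Node l r)
  have "dyck_word (Node l r) = (U # dyck_word l @ [D]) @ dyck_word r" by simp
  then have "contact_positions (dyck_word (Node l r)) =
      [0] @ map (\<lambda>k. k + length (U # dyck_word l @ [D])) (contact_positions (dyck_word r))"
    using contact_positions_append[of "U # dyck_word l @ [D]" "dyck_word r"]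
      contact_positions_prime[of l] by simp
  then show ?case using Node by simp
qed

lemma noninitial_contacts_dyck_word [simp]: "noninitial_contacts (dyck_word s) = spine s"
  using contact_positions_dyck_word[of s] by (simp add: noninitial_contacts_def)

lemma contact_at_graft:
  "rev (contact_positions (dyck_word (graft l r))) ! spine r = length (dyck_word l)"
proof -
  let ?c = "contact_positions (dyck_word r)"
  have len: "length ?c = Suc (spine r)" and hd: "hd ?c = 0"
    using contact_positions_dyck_word[of r] by auto
  then obtain c where c: "?c = 0 # c" "length c = spine r" by (cases ?c) auto
  then show ?thesis
    using contact_positions_append[of "dyck_word l" "dyck_word r"]
    by (simp add: nth_append)
qed

lemma left_part_graft: "left_part (dyck_word (graft l r)) (Suc (spine r)) = dyck_word l"
  and right_part_graft: "right_part (dyck_word (graft l r)) (Suc (spine r)) = dyck_word r"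
  using contact_at_graft[of l r] by (simp_all add: left_part_def right_part_def)

text \<open>
  The contact vector without its entry of index 0. The up step of a node is followed by its left
  subtree and a \<open>D\<close>, so that the maximal Dyck path after it is the left subtree.
\<close>

fun contacts :: "btree \<Rightarrow> nat list" where
  "contacts Leaf = []"
| "contacts (Node l r) = spine l # contacts l @ contacts r"

lemma contacts_graft [simp]: "contacts (graft s t) = contacts s @ contacts t"
  by (induction s) auto

lemma path_size_dyck_word [simp]: "path_size (dyck_word s) = length (contacts s)"
  by (induction s) auto

lemma after_up_append:
  "path_size p \<le> k \<Longrightarrow> after_up (Suc k) (p @ q) = after_up (Suc k - path_size p) q"
proof (induction "Suc k" p arbitrary: k rule: after_up.induct)
  case (3 m p)
  then show ?case by (cases m) auto
qed (auto)

lemma after_up_dyck_word: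
  "k < length (contacts s) \<Longrightarrow>
    \<exists>t r. after_up (Suc k) (dyck_word s @ q) = dyck_word t @ D # r \<and> spine t = contacts s ! k"
proof (induction s arbitrary: k q)
  case (Node a b)
  show ?case
  proof (cases k)
    case 0
    then show ?thesis
      by (intro exI[of _ a] exI[of _ "dyck_word b @ q"]) auto
  next
    case (Suc m)
    show ?thesis
    proof (cases "m < length (contacts a)")
      case True
      then show ?thesis using Node.IH(1)[of m "D # dyck_word b @ q"] Suc
        by (simp add: nth_append)
    next
      case False
      then have "after_up (Suc m) (dyck_word a @ D # dyck_word b @ q) =
          after_up (Suc (m - length (contacts a))) (dyck_word b @ q)"
        using after_up_append[of "dyck_word a" m "D # dyck_word b @ q"]
        by (simp add: Suc_diff_le)
      then show ?thesis using Node.IH(2)[of "m - length (contacts a)" q] Suc False Node.prems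
        by (auto simp: nth_append)
    qed
  qed
qed simp

lemma max_dyck_prefix_dyck_word:
  "max_dyck_prefix (dyck_word t @ D # r) = dyck_word t"
proof -
  let ?p = "dyck_word t @ D # r"
  have "Max {m. m \<le> length ?p \<and> dyck_path (take m ?p)} = length (dyck_word t)"
  proof (rule Max_eqI)
    show "finite {m. m \<le> length ?p \<and> dyck_path (take m ?p)}" by simp
    fix m assume "m \<in> {m. m \<le> length ?p \<and> dyck_path (take m ?p)}"
    then have m: "m \<le> length ?p" and d: "dyck_path (take m ?p)" by auto
    show "m \<le> length (dyck_word t)"
    proof (rule ccontr)
      assume "\<not> ?thesis"
      then have "Suc (length (dyck_word t)) \<le> m" by simp
      moreover from this have "take (Suc (length (dyck_word t))) (take m ?p) = dyck_word t @ [D]"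
        by (simp add: min_def take_Cons')
      ultimately have "0 \<le> path_height (dyck_word t @ [D])"
        using d m unfolding dyck_path_def by (metis length_take min.absorb2)
      then show False by simp
    qed
  qed simp
  then show ?thesis by (simp add: max_dyck_prefix_def)
qed

lemma contact_dyck_word:
  assumes "k \<le> length (contacts s)"
  shows "contact (dyck_word s) k = (spine s # contacts s) ! k"
proof (cases k)
  case 0
  then show ?thesis by (simp add: contact_def)
next
  case (Suc m)
  then obtain t r where "after_up k (dyck_word s) = dyck_word t @ D # r"
      "spine t = contacts s ! m"
    using after_up_dyck_word[of m s "[]"] assms by auto
  then show ?thesis
    using Suc max_dyck_prefix_dyck_word[of t r] by (simp add: contact_def)
qed

text \<open>
  The descents from left to right, that is, in the order opposite to \<^const>\<open>is_descent_vector\<close>.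
  In this order they run parallel to the contact vector: \<open>w\<^sub>i\<close> pairs \<open>c\<^sub>i\<close> with the \<open>i\<close>-th entry.
\<close>

fun descents :: "step list \<Rightarrow> nat list" where
  "descents [] = [0]"
| "descents (U # p) = 0 # descents p"
| "descents (D # p) = Suc (hd (descents p)) # tl (descents p)"

lemma length_descents [simp]: "length (descents p) = Suc (path_size p)"
  by (induction p rule: descents.induct) auto

lemma descents_nonempty [simp]: "descents p \<noteq> []"
  by (metis length_descents list.size(3) nat.distinct(1))

lemma path_of_descents:
  "p = replicate (hd (descents p)) D @ concat (map (\<lambda>d. U # replicate d D) (tl (descents p)))"
proof (induction p rule: descents.induct)
  case (2 p)
  then show ?case by (cases "descents p") auto
qed auto

lemma is_descent_vector_descents: "is_descent_vector (rev (descents p)) p"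
proof -
  let ?ds = "rev (descents p)" and ?n = "path_size p"
  have "map (\<lambda>k. ?ds ! k) (rev [0..<?n]) = rev (take ?n ?ds)"
    unfolding rev_map[symmetric] by (intro arg_cong[of _ _ rev] nth_equalityI) auto
  also have "\<dots> = tl (descents p)"
    by (cases "descents p") (use length_descents[of p] in auto)
  finally have "concat (map (\<lambda>k. U # replicate (?ds ! k) D) (rev [0..<?n])) =
      concat (map (\<lambda>d. U # replicate d D) (tl (descents p)))"
    by (metis (no_types, lifting) map_map comp_apply map_cong)
  moreover have "?ds ! ?n = hd (descents p)"
    by (simp add: rev_nth hd_conv_nth)
  ultimately show ?thesis
    using path_of_descents[of p] by (simp add: is_descent_vector_def)
qed

lemma descent_eq: "i \<le> path_size p \<Longrightarrow> descent p (path_size p - i) = descents p ! i"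
proof -
  assume i: "i \<le> path_size p"
  have "(THE ds. is_descent_vector ds p) = rev (descents p)"
    using ex1_descent_vector is_descent_vector_descents by (rule the1_equality)
  then show ?thesis using i by (simp add: descent_def rev_nth)
qed

text \<open>
  The first descent of a Dyck path is 0; the list below contains the others. In
  \<open>U l D r\<close> the displayed \<open>D\<close> prolongs the last descent of \<open>U l\<close>, where the descents of \<open>U l\<close> are
  those of \<open>l\<close> with a 0 in front, and that 0 is the last one if \<open>l\<close> is empty.
\<close>

fun tail_descents :: "btree \<Rightarrow> nat list" where
  "tail_descents Leaf = []"
| "tail_descents (Node l r) =
    butlast (0 # tail_descents l) @ Suc (last (0 # tail_descents l)) # tail_descents r"

lemma descents_append:
  "descents (p @ q) = butlast (descents p) @ (last (descents p) + hd (descents q)) # tl (descents q)"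
proof (induction p rule: descents.induct)
  case (3 p)
  then show ?case by (cases "descents p" rule: list.exhaust; cases "tl (descents p)") auto
qed auto

lemma descents_dyck_word: "descents (dyck_word t) = 0 # tail_descents t"
  by (induction t) (simp_all add: descents_append)

lemma last_tail_descents_pos: "t \<noteq> Leaf \<Longrightarrow> 0 < last (tail_descents t)"
  by (induction t) (auto simp: last_append, metis tail_descents.simps(1))

lemma tail_descents_eq_Nil [simp]: "tail_descents t = [] \<longleftrightarrow> t = Leaf"
  by (cases t) auto

lemma contacts_eq_Nil [simp]: "contacts t = [] \<longleftrightarrow> t = Leaf"
  by (cases t) auto


section \<open>The Tamari order on trees\<close>

text \<open>
  A cover moves a down step to the right over the prime factor that follows it. If it is the down
  step of a given node, then that prime factor is the first one of the right subtree, and it becomes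
  the last one of the left subtree: a rotation.
\<close>

inductive tree_cover :: "btree \<Rightarrow> btree \<Rightarrow> bool" where
  left: "tree_cover a b \<Longrightarrow> tree_cover (Node a r) (Node b r)"
| right: "tree_cover a b \<Longrightarrow> tree_cover (Node l a) (Node l b)"
| rotate: "tree_cover (Node l (Node c r)) (Node (graft l (Node c Leaf)) r)"

lemma tree_cover_NodeE:
  assumes "tree_cover s (Node l r)"
  obtains (left) l' where "s = Node l' r" "tree_cover l' l"
  | (right) r' where "s = Node l r'" "tree_cover r' r"
  | (rotate) l' c where "s = Node l' (Node c r)" "l = graft l' (Node c Leaf)"
  using assms by (auto elim: tree_cover.cases)

inductive_cases tree_cover_LeafE: "tree_cover s Leaf"

lemma prime_prefix_dyck_word:
  assumes "prime_dyck_path p" and "dyck_word t = p @ q"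
  shows "\<exists>c r. t = Node c r \<and> p = U # dyck_word c @ [D] \<and> q = dyck_word r"
proof (cases t)
  case Leaf
  then show ?thesis using assms by (simp add: prime_dyck_path_def)
next
  case (Node c r)
  have p: "path_height p = 0" "p \<noteq> []"
      "\<And>k. 0 < k \<Longrightarrow> k < length p \<Longrightarrow> path_height (take k p) \<noteq> 0"
    using assms(1) by (auto simp: prime_dyck_path_def dyck_path_def)
  have "(U # dyck_word c @ [D]) @ dyck_word r = p @ q" using Node assms(2) by simp
  then consider us where "U # dyck_word c @ [D] = p @ us" "us @ dyck_word r = q"
    | us where "(U # dyck_word c @ [D]) @ us = p" "dyck_word r = us @ q"
    unfolding append_eq_append_conv2 by blast
  then show ?thesis
  proof cases
    case 1
    have "us = []"
    proof (rule ccontr)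
      assume "us \<noteq> []"
      then obtain vs where "U # dyck_word c = p @ vs"
        using 1(1) by (metis append_Cons append_butlast_last_id butlast_append butlast_snoc)
      then obtain x where x: "p = U # x" "dyck_word c = x @ vs"
        using p(2) by (auto simp: Cons_eq_append_conv)
      then have "0 \<le> path_height x" using height_prefix_dyck_word by blast
      then show False using p(1) x by simp
    qed
    then show ?thesis using 1 Node by simp
  next
    case 2
    have "us = []"
    proof (rule ccontr)
      assume "us \<noteq> []"
      then have "length (U # dyck_word c @ [D]) < length p" 
        using 2(1) by (metis length_append length_greater_0_conv less_add_same_cancel1)
      then have "path_height (take (length (U # dyck_word c @ [D])) p) \<noteq> 0" by (intro p(3)) auto
      then show False using 2(1)[symmetric] by (simp del: append_Cons)
    qed
    then show ?thesis using 2 Node by simp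
  qed
qed

text \<open>
  The down step that moves is compared with the one that closes the first up step: if they agree, the
  cover is a rotation at the root; otherwise it takes place in the left or in the right subtree.
\<close>

lemma tree_cover_of_word:
  assumes "prime_dyck_path p" and "dyck_word s = x @ D # p @ y"
  shows "\<exists>t. x @ p @ D # y = dyck_word t \<and> tree_cover s t"
  using assms(2)
proof (induction s arbitrary: x y)
  case Leaf
  then show ?case by simp
next
  case (Node l r)
  obtain x' where x: "x = U # x'"
    using Node.prems by (cases x) auto
  have "dyck_word l @ D # dyck_word r = x' @ D # p @ y" using Node.prems x by simp
  then consider
      (match) "x' = dyck_word l" "dyck_word r = p @ y"
    | (later) vs where "x' = dyck_word l @ D # vs" "dyck_word r = vs @ D # p @ y"
    | (earlier) vs where "dyck_word l = x' @ D # vs" "vs @ D # dyck_word r = p @ y"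
    by (auto simp: append_eq_append_conv2 Cons_eq_append_conv append_eq_Cons_conv)
  then show ?case
  proof cases
    case match
    then obtain c r' where "r = Node c r'" "p = U # dyck_word c @ [D]" "y = dyck_word r'"
      using prime_prefix_dyck_word[OF assms(1)] by blast
    then show ?thesis
      using match x tree_cover.rotate[of l c r']
      by (intro exI[of _ "Node (graft l (Node c Leaf)) r'"]) auto
  next
    case later
    then obtain t where "vs @ p @ D # y = dyck_word t" "tree_cover r t"
      using Node.IH(2) by blast
    then show ?thesis using later x
      by (intro exI[of _ "Node l t"]) (auto intro: tree_cover.right)
  next
    case earlier
    have l: "dyck_word l = (x' @ [D]) @ vs" using earlier by simp
    have "0 \<le> path_height (x' @ [D])" using l by (rule height_prefix_dyck_word)
    moreover have "path_height (dyck_word l) = path_height (x' @ [D]) + path_height vs"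
      unfolding l by simp
    ultimately have vs: "path_height vs \<le> 0" by simp
    \<comment> \<open>The prime path cannot reach beyond the left subtree: it would have the prefix
      \<open>vs D\<close>, which ends below its starting level.\<close>
    obtain ws where ws: "vs = p @ ws" "y = ws @ D # dyck_word r"
    proof -
      consider us where "vs = p @ us" "us @ D # dyck_word r = y"
        | us where "vs @ us = p" "D # dyck_word r = us @ y"
        using earlier(2) unfolding append_eq_append_conv2 by blast
      then show thesis
      proof cases
        case 1
        then show ?thesis using that by auto
      next
        case 2
        show ?thesis
        proof (cases us)
          case Nil
          then show ?thesis using 2 that[of "[]"] by simp
        next
          case (Cons b us')
          then have "take (Suc (length vs)) p = vs @ [D]" "Suc (length vs) \<le> length p"
            using 2 by auto
          then have "0 \<le> path_height (vs @ [D])"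
            using assms(1) unfolding prime_dyck_path_def dyck_path_def by metis
          then show ?thesis using vs by simp
        qed
      qed
    qed
    then obtain t where "x' @ p @ D # ws = dyck_word t" "tree_cover l t"
      using Node.IH(1)[of x' ws] l by auto
    moreover have "x @ p @ D # y = U # (x' @ p @ D # ws) @ D # dyck_word r" using ws x by simp
    ultimately show ?thesis
      by (intro exI[of _ "Node t r"]) (simp add: tree_cover.left)
  qed
qed

lemma tamari_le_obtains_trees:
  assumes "tamari_le P Q"
  obtains s t where "P = dyck_word s" "Q = dyck_word t" "tree_cover\<^sup>*\<^sup>* s t"
proof -
  obtain s where s: "P = dyck_word s"
    using assms dyck_path_obtains_tree by (auto simp: tamari_le_def)
  have "tamari_cover\<^sup>*\<^sup>* P Q" using assms by (simp add: tamari_le_def)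
  then have "\<exists>t. Q = dyck_word t \<and> tree_cover\<^sup>*\<^sup>* s t"
  proof induction
    case base
    then show ?case using s by blast
  next
    case (step Y Z)
    then obtain t where t: "Y = dyck_word t" "tree_cover\<^sup>*\<^sup>* s t" by blast
    from step(2) obtain t' where "Z = dyck_word t'" "tree_cover t t'"
    proof cases
      case (1 A P1 B)
      then show ?thesis using tree_cover_of_word[of P1 t A B] t that by auto
    qed
    then show ?case using t rtranclp.rtrancl_into_rtrancl[of tree_cover s t t'] by blast
  qed
  then show thesis using s that by blast
qed

text \<open>
  The surrounding words are there for the induction, which descends into subtrees.
\<close>

lemma tamari_cover_of_tree_cover:
  "tree_cover s t \<Longrightarrow> dyck_path (x @ dyck_word s @ y) \<Longrightarrow>
    tamari_cover (x @ dyck_word s @ y) (x @ dyck_word t @ y)"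
proof (induction arbitrary: x y rule: tree_cover.induct)
  case (left a b r)
  then show ?case using left.IH[of "x @ [U]" "D # dyck_word r @ y"] by simp
next
  case (right a b l)
  then show ?case using right.IH[of "x @ U # dyck_word l @ [D]" y] by simp
next
  case (rotate l c r)
  have "path_height (take k (U # dyck_word c @ [D])) \<noteq> 0"
    if "0 < k" "k < length (U # dyck_word c @ [D])" for k
    using height_inside_prime[OF that] by simp
  moreover have "dyck_path (U # dyck_word c @ [D])"
    using dyck_path_dyck_word[of "Node c Leaf"] by simp
  ultimately have "prime_dyck_path (U # dyck_word c @ [D])"
    by (simp add: prime_dyck_path_def)
  then show ?case
    using tamari_cover.intros[of "x @ U # dyck_word l" "U # dyck_word c @ [D]" "dyck_word r @ y"]
      rotate by simp
qed

lemma tamari_le_of_tree_cover: "tree_cover\<^sup>*\<^sup>* s t \<Longrightarrow> tamari_le (dyck_word s) (dyck_word t)"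
proof (induction rule: rtranclp_induct)
  case base
  then show ?case by (simp add: tamari_le_def)
next
  case (step t u)
  then show ?case using tamari_cover_of_tree_cover[of t u "[]" "[]"]
    by (auto simp: tamari_le_def intro: rtranclp.rtrancl_into_rtrancl)
qed

lemma tree_cover_graft_left: "tree_cover a b \<Longrightarrow> tree_cover (graft a r) (graft b r)"
  by (induction rule: tree_cover.induct) (auto intro: tree_cover.intros)

lemma tree_cover_graft_right: "tree_cover a b \<Longrightarrow> tree_cover (graft l a) (graft l b)"
  by (induction l) (auto intro: tree_cover.intros)

text \<open>
  A rotation into a tree always moves the last prime factor of a left subtree, and a left subtree
  of \<open>graft r p\<close> lies entirely in \<open>r\<close> or entirely in \<open>p\<close>. So the cut between \<open>r\<close> and \<open>p\<close> persists
  when one goes down in the order.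
\<close>

lemma tree_cover_into_graft:
  "tree_cover s (graft r p) \<Longrightarrow>
    (\<exists>r'. s = graft r' p \<and> tree_cover r' r) \<or> (\<exists>p'. s = graft r p' \<and> tree_cover p' p)"
proof (induction r arbitrary: s)
  case Leaf
  then show ?case by auto
next
  case (Node a b)
  from Node.prems have "tree_cover s (Node a (graft b p))" by simp
  then show ?case
  proof (cases rule: tree_cover_NodeE)
    case (left a')
    then have "s = graft (Node a' b) p \<and> tree_cover (Node a' b) (Node a b)"
      by (auto intro: tree_cover.left)
    then show ?thesis by blast
  next
    case (right b')
    then show ?thesis using Node.IH(2)[of b']
      by (metis graft.simps(2) tree_cover.right)
  next
    case (rotate l c)
    then have "s = graft (Node l (Node c b)) p \<and> tree_cover (Node l (Node c b)) (Node a b)"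
      by (auto intro: tree_cover.rotate)
    then show ?thesis by blast
  qed
qed

text \<open>
  This is the surjectivity of \<^const>\<open>interval_oplus\<close>. At \<open>s = Node q q'\<close> itself the right part \<open>r\<close> is
  empty; each downward rotation at the root transfers the last prime factor of \<open>l\<close> to the front of
  \<open>r\<close>, and the tree \<open>graft l r\<close> stays the same.
\<close>

lemma tree_interval_decomposition:
  "tree_cover\<^sup>*\<^sup>* s (Node q q') \<Longrightarrow>
    \<exists>l r p. s = Node l (graft r p) \<and> tree_cover\<^sup>*\<^sup>* (graft l r) q \<and> tree_cover\<^sup>*\<^sup>* p q'"
proof (induction rule: converse_rtranclp_induct)
  case base
  show ?case by (intro exI[of _ q] exI[of _ Leaf] exI[of _ q']) auto
next
  case (step s t)
  then obtain l r p where t: "t = Node l (graft r p)"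
    and le: "tree_cover\<^sup>*\<^sup>* (graft l r) q" "tree_cover\<^sup>*\<^sup>* p q'" by blast
  from step(1) have "tree_cover s (Node l (graft r p))" using t by simp
  then show ?case
  proof (cases rule: tree_cover_NodeE)
    case (left l')
    then show ?thesis using le tree_cover_graft_left[of l' l r]
      by (metis converse_rtranclp_into_rtranclp)
  next
    case (right b)
    then consider r' where "b = graft r' p" "tree_cover r' r"
      | p' where "b = graft r p'" "tree_cover p' p"
      using tree_cover_into_graft by blast
    then show ?thesis
      using right le tree_cover_graft_right[of _ r l] by cases (metis converse_rtranclp_into_rtranclp)+
  next
    case (rotate l' c)
    then show ?thesis using le
      by (intro exI[of _ l'] exI[of _ "Node c r"] exI[of _ p]) (auto simp: graft_assoc)
  qed
qed


section \<open>Extended fighting fish are closed under concatenation and augmentation\<close>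

text \<open>
  Together these say that a fish is \<open>E\<^sup>j N G S\<close> with \<open>j \<ge> 1\<close>, in a form that can be checked for
  each of the three operations by asking whether the replaced factor lies behind the jaw.
\<close>

lemma fighting_fish_ends:
  "fighting_fish F \<Longrightarrow> F \<noteq> [] \<and> hd F = E \<and> last F = S
    \<and> (\<exists>x\<in>set F. x \<noteq> E) \<and> hd (dropWhile (\<lambda>x. x = E) F) = N"
proof (induction rule: fighting_fish.induct)
  case (split_W A B)
  then show ?case by (cases "\<forall>a\<in>set A. a = E") (auto simp: hd_append dropWhile_append split: if_splits)
next
  case (split_N A B)
  then show ?case by (cases "\<forall>a\<in>set A. a = E") (auto simp: hd_append dropWhile_append split: if_splits)
next
  case (glue A B)
  then show ?case by (cases "\<forall>a\<in>set A. a = E") (auto simp: hd_append dropWhile_append split: if_splits)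
qed auto

lemma fighting_fish_shape:
  assumes "fighting_fish F"
  obtains j G where "0 < j" "F = replicate j E @ N # G @ [S]"
proof -
  let ?j = "length (takeWhile (\<lambda>x. x = E) F)"
  note ends = fighting_fish_ends[OF assms]
  have "takeWhile (\<lambda>x. x = E) F = replicate ?j E"
    by (rule replicate_eqI) (auto dest: set_takeWhileD)
  moreover have "dropWhile (\<lambda>x. x = E) F \<noteq> []" using ends by (simp add: dropWhile_eq_Nil_conv)
  moreover obtain H where H: "dropWhile (\<lambda>x. x = E) F = N # H"
    using ends calculation(2) by (metis list.exhaust_sel)
  ultimately have F: "F = replicate ?j E @ N # H" by (metis takeWhile_dropWhile_id)
  have "H \<noteq> []" "last H = S" using ends F
    by (metis last.simps last_appendR letter.distinct(11) list.distinct(1))+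
  moreover have "0 < ?j" using ends by (cases F) auto
  ultimately show thesis using F that by (metis append_butlast_last_id)
qed

lemma prefix_of_replicate_E:
  assumes "A @ x # B = replicate i E @ R" "x \<noteq> E"
  shows "\<exists>A'. A = replicate i E @ A' \<and> R = A' @ x # B"
  using assms(1)
proof (induction i arbitrary: A)
  case (Suc i)
  then obtain A' where "A = E # A'" using assms(2) by (cases A) auto
  then show ?case using Suc by auto
qed simp

text \<open>
  The operations that build \<open>F\<close> can be repeated behind the inserted \<open>N\<close>, unless a splitting of the
  first \<open>N\<close> creates the last \<open>E\<close> of \<open>E\<^sup>i\<close>. In that case one inserts \<open>N\<close> behind the shorter jaw
  \<open>E\<^sup>i\<^sup>-\<^sup>1\<close> and splits this new \<open>N\<close> into \<open>E N W\<close>; gluing its \<open>W\<close> with the old \<open>N\<close> gives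
  \<open>E\<^sup>i N N W\<close>, as required.
\<close>

lemma fighting_fish_augment:
  "fighting_fish F \<Longrightarrow> F = replicate i E @ R \<Longrightarrow> 0 < i \<Longrightarrow>
    fighting_fish (replicate i E @ N # R @ [S])"
proof (induction arbitrary: i R rule: fighting_fish.induct)
  case start
  have "i = 1" "R = [N, W, S]"
    using start by (cases i; cases "i - 1"; auto)+
  then show ?case using split_W[of "[E, N]" "[S]"] fighting_fish.start by simp
next
  case (split_W A B)
  then obtain A' where "A = replicate i E @ A'" "R = A' @ N # W # S # B"
    using prefix_of_replicate_E[of A N "W # S # B" i R] by auto
  then show ?case
    using split_W.IH[of i "A' @ W # B"] split_W.prems
      fighting_fish.split_W[of "replicate i E @ N # A'" "B @ [S]"] by simp
next
  case (glue A B)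
  then obtain A' where "A = replicate i E @ A'" "R = A' @ N # W # B"
    using prefix_of_replicate_E[of A N "W # B" i R] by auto
  then show ?case
    using glue.IH[of i "A' @ W # N # B"] glue.prems
      fighting_fish.glue[of "replicate i E @ N # A'" "B @ [S]"] by simp
next
  case (split_N A B)
  have "(A @ [E]) @ N # W # B = replicate i E @ R" using split_N.prems by simp
  then obtain A' where A': "A @ [E] = replicate i E @ A'" "R = A' @ N # W # B"
    using prefix_of_replicate_E[of "A @ [E]" N "W # B" i R] by blast
  show ?case
  proof (cases A' rule: rev_cases)
    case Nil
    obtain m where m: "i = Suc m" using split_N.prems by (cases i) auto
    then have A: "A = replicate m E" using A' Nil by (simp add: replicate_append_same[symmetric])
    have "A \<noteq> []" using fighting_fish_ends[OF split_N.hyps] by (cases A) auto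
    then have "fighting_fish (A @ [N] @ N # B @ [S])"
      using split_N.IH[of m "N # B"] A by auto
    then have "fighting_fish (A @ [E, N, W] @ N # B @ [S])" by (rule fighting_fish.split_N)
    then have "fighting_fish (A @ [E, N, N, W] @ B @ [S])"
      using fighting_fish.glue[of "A @ [E, N]" "B @ [S]"] by simp
    moreover have "A @ [E] = replicate i E" using A' Nil by simp
    ultimately show ?thesis using A'(2) Nil by (metis append.assoc append_Cons append_Nil)
  next
    case (snoc A'' a)
    then have "A = replicate i E @ A''" "a = E" using A' by auto
    then show ?thesis
      using split_N.IH[of i "A'' @ N # B"] split_N.prems A'(2) snoc
        fighting_fish.split_N[of "replicate i E @ N # A''" "B @ [S]"] by simp
  qed
qed

text \<open>
  A fish without its final \<open>S\<close> can be grown in place of any letter \<open>N\<close>: the step from \<open>N\<close> to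
  \<open>E N W\<close> is a splitting, and the operations that grow \<open>F\<close> from \<open>E N W S\<close> never change the final
  \<open>S\<close>. Concatenation of fish is the case where this \<open>N\<close> follows the jaw of the second fish.
\<close>

lemma fighting_fish_substitute:
  "fighting_fish F \<Longrightarrow> fighting_fish (x @ N # y) \<Longrightarrow> fighting_fish (x @ butlast F @ y)"
proof (induction rule: fighting_fish.induct)
  case start
  then show ?case using fighting_fish.split_N[of x y] by simp
next
  case (split_W A B)
  then have "B \<noteq> []" using fighting_fish_ends by fastforce
  then show ?case using split_W fighting_fish.split_W[of "x @ A" "butlast B @ y"]
    by (simp add: butlast_append)
next
  case (split_N A B)
  then have "B \<noteq> []" using fighting_fish_ends by fastforce
  then show ?case using split_N fighting_fish.split_N[of "x @ A" "butlast B @ y"]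
    by (simp add: butlast_append)
next
  case (glue A B)
  then have "B \<noteq> []" using fighting_fish_ends by fastforce
  then show ?case using glue fighting_fish.glue[of "x @ A" "butlast B @ y"]
    by (simp add: butlast_append)
qed

lemma contract_WN_append:
  "contract_WN A B \<Longrightarrow> contract_WN A' B' \<Longrightarrow> contract_WN (A @ A') (B @ B')"
  by (induction rule: contract_WN.induct) (auto intro: contract_WN.intros)

lemma contract_WN_refl: "contract_WN A A"
  by (induction A) (auto intro: contract_WN.intros)

text \<open>
  The jaw, the \<open>N\<close> after it and the final letter are untouched by contractions, since no factor
  \<open>WN\<close> overlaps them. Hence
  concatenation and augmentation can be performed before contracting.
\<close>

lemma contract_WN_prefixE:
  assumes "contract_WN (replicate j E @ N # A) B"
  obtains B' where "B = replicate j E @ N # B'" "contract_WN A B'"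
  using assms
proof (induction j arbitrary: B thesis)
  case 0
  then show ?case by (auto elim: contract_WN.cases)
next
  case (Suc j)
  from Suc.prems(2) obtain C where "B = E # C" "contract_WN (replicate j E @ N # A) C"
    by (auto elim: contract_WN.cases)
  then show ?case using Suc by (metis append_Cons replicate_Suc)
qed

lemma contract_WN_suffixE:
  assumes "contract_WN (A @ [S]) B"
  obtains B' where "B = B' @ [S]" "contract_WN A B'"
proof -
  have "\<exists>B'. B = B' @ [S] \<and> contract_WN A B'"
    using assms
  proof (induction "A @ [S]" B arbitrary: A rule: contract_WN.induct)
    case nil
    then show ?case by simp
  next
    case (keep A0 B x)
    show ?case
    proof (cases A)
      case Nil
      then have "A0 = []" "x = S" using keep by auto
      then show ?thesis using keep(1) Nil by (auto elim: contract_WN.cases intro: contract_WN.nil)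
    next
      case (Cons a A')
      then show ?thesis using keep by (metis append_Cons contract_WN.keep list.inject)
    qed
  next
    case (contract A0 B)
    then obtain A' where "A = W # N # A'" "A0 = A' @ [S]"
      by (cases A; cases "tl A") auto
    then show ?case using contract by (metis append_Cons contract_WN.contract)
  qed
  then show thesis using that by blast
qed

lemma extended_fish_shape:
  assumes "extended_fighting_fish F" "F \<noteq> empty_fish"
  obtains j G G' where "0 < j" "F = replicate j E @ N # G @ [S]"
    "contract_WN G' G" "fighting_fish (replicate j E @ N # G' @ [S])"
proof -
  obtain F' where F': "fighting_fish F'" "contract_WN F' F"
    using assms by (auto simp: extended_fighting_fish_def)
  obtain j G' where G': "0 < j" "F' = replicate j E @ N # G' @ [S]"
    using fighting_fish_shape[OF F'(1)] .
  then obtain H where H: "F = replicate j E @ N # H" "contract_WN (G' @ [S]) H"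
    using contract_WN_prefixE F'(2) by metis
  then obtain G where "H = G @ [S]" "contract_WN G' G"
    using contract_WN_suffixE by metis
  then show thesis using that G' H F' by metis
qed

lemma replicate_E_N_not_empty: "replicate j E @ N # G \<noteq> empty_fish"
  by (cases j; cases "j - 1") (auto simp: empty_fish_def)

lemma jaw_replicate [simp]: "jaw (replicate j E @ N # G) = j"
  by (simp add: jaw_def replicate_E_N_not_empty takeWhile_append)

lemma fish_augment_inner:
  "i \<le> j \<Longrightarrow> fish_augment i (replicate j E @ N # G) =
    replicate i E @ N # replicate (j - i) E @ N # G @ [S]"
  by (simp add: fish_augment_def replicate_E_N_not_empty)

lemma fish_augment_outer:
  "fish_augment (Suc j) (replicate j E @ N # G) = replicate (Suc j) E @ N # V # G @ [S]"
  by (simp add: fish_augment_def replicate_E_N_not_empty)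

lemma extended_fighting_fish_concat:
  assumes "extended_fighting_fish F1" "extended_fighting_fish F2"
  shows "extended_fighting_fish (fish_concat F1 F2)"
proof (cases "F1 = empty_fish \<or> F2 = empty_fish")
  case True
  then show ?thesis using assms by (auto simp: fish_concat_def)
next
  case False
  obtain j1 G1 G1' where 1: "F1 = replicate j1 E @ N # G1 @ [S]"
    "contract_WN G1' G1" "fighting_fish (replicate j1 E @ N # G1' @ [S])"
    using extended_fish_shape assms(1) False by metis
  obtain j2 G2 G2' where 2: "F2 = replicate j2 E @ N # G2 @ [S]"
    "contract_WN G2' G2" "fighting_fish (replicate j2 E @ N # G2' @ [S])"
    using extended_fish_shape assms(2) False by metis
  have "fish_concat F1 F2 = replicate j2 E @ (replicate j1 E @ N # G1) @ G2 @ [S]"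
    using False by (simp add: fish_concat_def 1(1) 2(1) butlast_append)
  moreover have "fighting_fish (replicate j2 E @ (replicate j1 E @ N # G1') @ G2' @ [S])"
    using fighting_fish_substitute[OF 1(3) 2(3)] by (simp add: butlast_append)
  moreover have "contract_WN (replicate j2 E @ (replicate j1 E @ N # G1') @ G2' @ [S])
      (replicate j2 E @ (replicate j1 E @ N # G1) @ G2 @ [S])"
    using 1(2) 2(2) by (intro contract_WN_append contract_WN.keep contract_WN_refl)
  ultimately show ?thesis unfolding extended_fighting_fish_def by metis
qed

lemma extended_fighting_fish_augment:
  assumes "extended_fighting_fish F" "1 \<le> i" "i \<le> jaw F + 1"
  shows "extended_fighting_fish (fish_augment i F)"
proof (cases "F = empty_fish")
  case True
  then show ?thesis using fighting_fish.start contract_WN_refl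
    by (auto simp: fish_augment_def extended_fighting_fish_def)
next
  case False
  obtain j G G' where F: "0 < j" "F = replicate j E @ N # G @ [S]"
    "contract_WN G' G" "fighting_fish (replicate j E @ N # G' @ [S])"
    using extended_fish_shape assms(1) False by metis
  show ?thesis
  proof (cases "i \<le> j")
    case True
    have split: "replicate j E = replicate i E @ replicate (j - i) E"
      using True by (simp add: replicate_add[symmetric])
    have "fish_augment i F = replicate i E @ N # replicate (j - i) E @ N # G @ [S, S]"
      using True by (simp add: F(2) fish_augment_inner)
    moreover have "fighting_fish (replicate i E @ N # replicate (j - i) E @ N # G' @ [S, S])"
      using fighting_fish_augment[OF F(4), of i "replicate (j - i) E @ N # G' @ [S]"] split assms(2)
      by simp
    ultimately show ?thesis using F(3) unfolding extended_fighting_fish_def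
      by (metis contract_WN_append contract_WN.keep contract_WN_refl)
  next
    case i: False
    then have "i = Suc j" using assms(3) F(2) by simp
    then have "fish_augment i F = replicate (Suc j) E @ N # V # G @ [S, S]"
      by (simp add: F(2) fish_augment_outer)
    moreover have "fighting_fish (replicate j E @ [N] @ N # G' @ [S, S])"
      using fighting_fish_augment[OF F(4), of j] F(1) by simp
    \<comment> \<open>Splitting the inserted \<open>N\<close> produces the longer jaw, and a factor \<open>WN\<close> to be contracted.\<close>
    then have "fighting_fish (replicate j E @ [E, N, W] @ N # G' @ [S, S])"
      by (rule fighting_fish.split_N)
    then have "fighting_fish (replicate (Suc j) E @ N # W # N # G' @ [S, S])"
      by (simp add: replicate_app_Cons_same)
    ultimately show ?thesis using F(3) unfolding extended_fighting_fish_def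
      by (metis contract_WN_append contract_WN.keep contract_WN.contract contract_WN_refl)
  qed
qed


section \<open>The word of an interval follows the recursion\<close>

definition fish_body :: "btree \<Rightarrow> btree \<Rightarrow> letter list" where
  "fish_body s t = concat (map2 fish_factor (contacts s) (tail_descents t))"

text \<open>
  The letter \<open>E\<close> in front and the factor of index 0 form the jaw with its \<open>N\<close>, except for the empty
  fish, whose factor of index 0 is \<open>V\<close>.
\<close>

definition fish_word :: "btree \<Rightarrow> btree \<Rightarrow> letter list" where
  "fish_word s t = E # fish_factor (spine s) 0 @ fish_body s t @ [S]"

text \<open>
  The condition under which the factors of index at least 1 are specified. It includes equality of
  the two list lengths, that is, of the path sizes.
\<close>

definition compatible :: "btree \<Rightarrow> btree \<Rightarrow> bool" where
  "compatible s t \<longleftrightarrow> list_all2 (\<lambda>c d. c = 0 \<or> d = 0) (contacts s) (tail_descents t)"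

lemma fish_word_Leaf: "fish_word Leaf Leaf = empty_fish"
  by (simp add: fish_word_def fish_body_def fish_factor_def empty_fish_def)

lemma fish_word_nonempty:
  "s \<noteq> Leaf \<Longrightarrow> fish_word s t = replicate (spine s) E @ N # fish_body s t @ [S]"
  by (cases s) (auto simp: fish_word_def fish_factor_def)

lemma compatible_Leaf: "compatible s t \<Longrightarrow> s = Leaf \<longleftrightarrow> t = Leaf"
  unfolding compatible_def by (metis contacts_eq_Nil tail_descents_eq_Nil list_all2_Nil list_all2_Nil2)

lemma jaw_fish_word: "compatible s t \<Longrightarrow> jaw (fish_word s t) = spine s"
  using compatible_Leaf[of s t]
  by (cases "s = Leaf") (auto simp: fish_word_Leaf jaw_def[of empty_fish] fish_word_nonempty)

text \<open>
  A non-empty Dyck path ends with a down step, so its last descent is positive and the last contact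
  number has to vanish. Hence increasing that descent by 1, as augmentation does, only appends an
  \<open>S\<close> to the last factor.
\<close>

lemma compatible_snoc:
  assumes "compatible s t" "t \<noteq> Leaf"
  obtains cs ds d where "contacts s = cs @ [0]" "tail_descents t = ds @ [Suc d]"
    "list_all2 (\<lambda>c d. c = 0 \<or> d = 0) cs ds"
proof -
  obtain ds e where ds: "tail_descents t = ds @ [e]"
    using assms(2) by (metis rev_exhaust tail_descents_eq_Nil)
  then obtain d where "e = Suc d" using last_tail_descents_pos[OF assms(2)] by (cases e) auto
  moreover obtain cs c where "contacts s = cs @ [c]"
    "list_all2 (\<lambda>c d. c = 0 \<or> d = 0) cs ds" "c = 0 \<or> e = 0"
    using assms(1) ds unfolding compatible_def by (auto simp: list_all2_append2 list_all2_Cons2)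
  ultimately show thesis using that ds by auto
qed

lemma compatible_Node:
  assumes "compatible (graft l r) t1" "compatible s2 t2"
  shows "compatible (Node l (graft r s2)) (Node t1 t2)"
proof (cases "t1 = Leaf")
  case True
  then have "graft l r = Leaf" using compatible_Leaf[OF assms(1)] by simp
  then have "l = Leaf" "r = Leaf" by (cases l; simp)+
  then show ?thesis using True assms(2) by (simp add: compatible_def)
next
  case False
  obtain cs ds d where *: "contacts (graft l r) = cs @ [0]" "tail_descents t1 = ds @ [Suc d]"
    "list_all2 (\<lambda>c d. c = 0 \<or> d = 0) cs ds"
    using compatible_snoc[OF assms(1) False] .
  have "contacts (Node l (graft r s2)) = spine l # (cs @ [0]) @ contacts s2"
    using *(1) by simp
  moreover have "tail_descents (Node t1 t2) = 0 # (ds @ [Suc (Suc d)]) @ tail_descents t2"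
    using *(2) by simp
  ultimately show ?thesis using *(3) assms(2) unfolding compatible_def
    by (simp only: list_all2_Cons) (intro conjI list_all2_appendI; simp)
qed

lemma fish_body_Node:
  assumes "compatible (graft l r) t1" "t1 \<noteq> Leaf"
  shows "fish_body (Node l (graft r s2)) (Node t1 t2) =
    fish_factor (spine l) 0 @ fish_body (graft l r) t1 @ [S] @ fish_body s2 t2"
proof -
  obtain cs ds d where *: "contacts (graft l r) = cs @ [0]" "tail_descents t1 = ds @ [Suc d]"
    "list_all2 (\<lambda>c d. c = 0 \<or> d = 0) cs ds"
    using compatible_snoc[OF assms] .
  have len: "length cs = length ds" using *(3) by (rule list_all2_lengthD)
  have c: "contacts (Node l (graft r s2)) = spine l # cs @ [0] @ contacts s2"
    using *(1) by simp
  have d: "tail_descents (Node t1 t2) = 0 # ds @ [Suc (Suc d)] @ tail_descents t2"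
    using *(2) by simp
  show ?thesis
    unfolding fish_body_def c d *(1,2) using len
    by (simp add: fish_factor_def[of 0 "Suc _"] replicate_append_same[symmetric])
qed

text \<open>
  The word of the augmentation alone ends with \<open>S\<close>, like every fish; concatenation drops this \<open>S\<close> and
  puts the rest between the jaw and the body of the second fish. Therefore it suffices to know that the
  augmentation is \<open>E\<^sup>i N H S\<close>, with \<open>H\<close> the part of the new body in front of the body of \<open>s2\<close>.
\<close>

lemma fish_word_oplus:
  assumes "compatible (graft l r) t1" "compatible s2 t2"
  shows "fish_word (Node l (graft r s2)) (Node t1 t2) =
    fish_oplus (fish_word (graft l r) t1) (Suc (spine r)) (fish_word s2 t2)"
proof -
  let ?F2 = "fish_word s2 t2" and ?j2 = "spine s2"
  let ?s1 = "graft l r" and ?i = "Suc (spine r)"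
  obtain H where H: "fish_augment ?i (fish_word ?s1 t1) = replicate ?i E @ N # H @ [S]"
    and body: "fish_body (Node l (graft r s2)) (Node t1 t2) = H @ fish_body s2 t2"
  proof (cases "t1 = Leaf")
    case True
    then have "?s1 = Leaf" using compatible_Leaf[OF assms(1)] by simp
    then have "l = Leaf" "r = Leaf" by (cases l; simp)+
    then show ?thesis using True that[of "[W]"]
      by (simp add: fish_word_Leaf fish_augment_def fish_body_def fish_factor_def[of 0 "Suc 0"])
  next
    case False
    then have s1: "?s1 \<noteq> Leaf" using compatible_Leaf[OF assms(1)] by simp
    show ?thesis
    proof (rule that)
      show "fish_body (Node l (graft r s2)) (Node t1 t2) =
          (fish_factor (spine l) 0 @ fish_body ?s1 t1 @ [S]) @ fish_body s2 t2"
        using fish_body_Node[OF assms(1) False] by simp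
      show "fish_augment ?i (fish_word ?s1 t1) =
          replicate ?i E @ N # (fish_factor (spine l) 0 @ fish_body ?s1 t1 @ [S]) @ [S]"
        using s1 by (cases "spine l")
          (simp_all add: fish_word_nonempty fish_augment_inner fish_augment_outer fish_factor_def
            del: replicate_Suc)
    qed
  qed
  show ?thesis
  proof (cases "s2 = Leaf")
    case True
    then have "t2 = Leaf" using compatible_Leaf[OF assms(2)] by simp
    then show ?thesis using True H body
      by (simp add: fish_oplus_def fish_concat_def fish_word_Leaf fish_word_nonempty)
        (simp add: fish_body_def)
  next
    case False
    then have F2: "?F2 = replicate ?j2 E @ N # fish_body s2 t2 @ [S]" by (rule fish_word_nonempty)
    have "fish_oplus (fish_word ?s1 t1) ?i ?F2 =
        replicate ?j2 E @ (replicate ?i E @ N # H) @ fish_body s2 t2 @ [S]"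
      unfolding fish_oplus_def fish_concat_def H F2
      by (simp only: replicate_E_N_not_empty if_False jaw_replicate) (simp add: butlast_append)
    also have "\<dots> = replicate (spine (Node l (graft r s2))) E @ N #
        fish_body (Node l (graft r s2)) (Node t1 t2) @ [S]"
      unfolding body by (simp add: replicate_add[symmetric] add.commute flip: append_assoc replicate_Suc)
    also have "\<dots> = fish_word (Node l (graft r s2)) (Node t1 t2)"
      by (rule fish_word_nonempty[symmetric]) simp
    finally show ?thesis ..
  qed
qed

lemma interval_oplus_graft:
  "interval_oplus (dyck_word (graft l r), dyck_word t1) (Suc (spine r)) (dyck_word s2, dyck_word t2) =
    (dyck_word (Node l (graft r s2)), dyck_word (Node t1 t2))"
  unfolding interval_oplus_def interval_concat_def interval_augment_def fst_conv snd_conv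
    left_part_graft right_part_graft by simp

lemma Phi_graph_fish_word:
  "Phi_graph I F \<Longrightarrow> \<exists>s t. I = (dyck_word s, dyck_word t) \<and> compatible s t
    \<and> F = fish_word s t \<and> extended_fighting_fish F"
proof (induction rule: Phi_graph.induct)
  case empty
  then show ?case
    by (intro exI[of _ Leaf])
      (simp add: compatible_def fish_word_Leaf extended_fighting_fish_def)
next
  case (oplus I1 i I2 F1 F2)
  obtain s1 t1 where 1: "I1 = (dyck_word s1, dyck_word t1)" "compatible s1 t1"
    "F1 = fish_word s1 t1" "extended_fighting_fish F1" using oplus.IH(1) by blast
  obtain s2 t2 where 2: "I2 = (dyck_word s2, dyck_word t2)" "compatible s2 t2"
    "F2 = fish_word s2 t2" "extended_fighting_fish F2" using oplus.IH(2) by blast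
  have i: "1 \<le> i" "i \<le> spine s1 + 1"
    using oplus.hyps(1) 1(1) by (auto simp: pointed_interval_def interval_contact_def contact_def)
  then obtain k where "i = Suc k" "k \<le> spine s1" by (cases i) auto
  then obtain l r where s1: "s1 = graft l r" "i = Suc (spine r)"
    using graft_split by metis
  have "extended_fighting_fish (fish_oplus F1 i F2)"
    unfolding fish_oplus_def using i 1 2
    by (intro extended_fighting_fish_concat extended_fighting_fish_augment)
      (simp_all add: jaw_fish_word)
  then show ?case
    using 1 2 s1 interval_oplus_graft fish_word_oplus compatible_Node by metis
qed

lemma tree_cover_to_Leaf: "tree_cover\<^sup>*\<^sup>* s Leaf \<Longrightarrow> s = Leaf"
  by (erule rtranclp.cases) (auto elim: tree_cover_LeafE)

text \<open>
  Induction on the upper path, whose first-return decomposition dictates how to split the lower one.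
\<close>

lemma Phi_graph_total:
  "tree_cover\<^sup>*\<^sup>* s t \<Longrightarrow> \<exists>F. Phi_graph (dyck_word s, dyck_word t) F"
proof (induction t arbitrary: s)
  case Leaf
  then have "s = Leaf" by (rule tree_cover_to_Leaf)
  then show ?case using Phi_graph.empty by auto
next
  case (Node t1 t2)
  obtain l r s2 where s: "s = Node l (graft r s2)"
    and le: "tree_cover\<^sup>*\<^sup>* (graft l r) t1" "tree_cover\<^sup>*\<^sup>* s2 t2"
    using tree_interval_decomposition[OF Node.prems] by blast
  obtain F1 F2 where F: "Phi_graph (dyck_word (graft l r), dyck_word t1) F1"
      "Phi_graph (dyck_word s2, dyck_word t2) F2"
    using Node.IH le by blast
  have "pointed_interval (dyck_word (graft l r), dyck_word t1) (Suc (spine r))"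
    unfolding pointed_interval_def tamari_interval_def interval_contact_def contact_def
    using tamari_le_of_tree_cover[OF le(1)] noninitial_contacts_dyck_word[of "graft l r"] by simp
  moreover have "tamari_interval (dyck_word s2, dyck_word t2)"
    using tamari_le_of_tree_cover[OF le(2)] by (simp add: tamari_interval_def)
  ultimately show ?case
    using Phi_graph.oplus[OF _ _ F] interval_oplus_graft s by metis
qed

lemma concat_factors:
  assumes "compatible s t" and n: "n = length (contacts s)"
    and w: "\<And>i. i \<le> n \<Longrightarrow> w i = fish_factor (contact (dyck_word s) i) (descent (dyck_word t) (n - i))"
  shows "[E] @ concat (map w [0..<n + 1]) @ [S] = fish_word s t"
proof -
  have len: "length (contacts s) = length (tail_descents t)"
    using assms(1) unfolding compatible_def by (rule list_all2_lengthD)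
  have size: "path_size (dyck_word t) = n"
    using length_descents[of "dyck_word t"] unfolding descents_dyck_word n using len by simp
  have "map w [0..<n + 1] = map2 fish_factor (spine s # contacts s) (0 # tail_descents t)"
  proof (rule nth_equalityI)
    show "length (map w [0..<n + 1]) =
        length (map2 fish_factor (spine s # contacts s) (0 # tail_descents t))"
      using len n by simp
    fix i assume "i < length (map w [0..<n + 1])"
    then have i: "i \<le> n" by simp
    have "map w [0..<n + 1] ! i = w i" using i by (simp del: upt_Suc)
    also have "\<dots> = fish_factor ((spine s # contacts s) ! i) ((0 # tail_descents t) ! i)"
      using w[OF i] contact_dyck_word[of i s] descent_eq[of i "dyck_word t"] i n size
      by (simp add: descents_dyck_word)
    also have "\<dots> = map2 fish_factor (spine s # contacts s) (0 # tail_descents t) ! i"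
      using i n len by (subst nth_map) (simp_all del: zip_Cons_Cons)
    finally show "map w [0..<n + 1] ! i =
        map2 fish_factor (spine s # contacts s) (0 # tail_descents t) ! i" .
  qed
  then show ?thesis by (simp add: fish_word_def fish_body_def del: upt_Suc)
qed

theorem theorem3:
  fixes I :: interval and n :: nat and w :: "nat \<Rightarrow> letter list"
  assumes "tamari_interval I"
    and "interval_size I = n"
    and "\<And>i. i \<le> n \<Longrightarrow> w i = fish_factor (interval_contact I i) (interval_descent I (n - i))"
  shows "extended_fighting_fish ([E] @ concat (map w [0..<n + 1]) @ [S])
    \<and> [E] @ concat (map w [0..<n + 1]) @ [S] = Phi I"
proof -
  let ?F = "[E] @ concat (map w [0..<n + 1]) @ [S]"
  have F: "F = ?F \<and> extended_fighting_fish F" if graph: "Phi_graph I F" for F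
  proof -
    obtain s t where *: "I = (dyck_word s, dyck_word t)" "compatible s t"
      "F = fish_word s t" "extended_fighting_fish F"
      using Phi_graph_fish_word[OF graph] by blast
    have "?F = fish_word s t"
      using assms(2,3) *(1)
      by (intro concat_factors *(2))
        (auto simp: interval_size_def interval_contact_def interval_descent_def)
    then show ?thesis using * by simp
  qed
  obtain s t where "fst I = dyck_word s" "snd I = dyck_word t" "tree_cover\<^sup>*\<^sup>* s t"
    using assms(1) tamari_le_obtains_trees unfolding tamari_interval_def by metis
  then obtain F where "Phi_graph I F" using Phi_graph_total by (metis prod.collapse)
  moreover from this have "Phi I = F" unfolding Phi_def using F by (metis the_equality)
  ultimately show ?thesis using F by metis
qed

end
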